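(* Let $f$ be a trigonometric polynomial of degree at most $d$. Suppose that $|f(\zeta)|\le1$ for all $\zeta\in\mathbb T$. Then $$\|f(U)-f(V)\|\le d\,\|U-V\|$$ for all unitary operators $U$ and $V$ on a Hilbert space.
   Context: $\mathbb T$ is the unit circle in $\mathbb C$. A trigonometric polynomial of degree at most $d$ is a function $f(\zeta)=\sum_{k=-d}^d a_k\zeta^k$, $\zeta\in\mathbb T$, with $a_k\in\mathbb C$; $f(U)=\sum_{k=-d}^d a_kU^k$ for unitary $U$. *)

theory Defs
  imports "HOL-Analysis.Analysis"
begin

text \<open>
  Complex Hilbert spaces, built on top of the library's real Banach spaces so that the norm, the
  metric and the operator norm \<^const>\<open>onorm\<close> are the library's own. The inner product is linear in
  its first argument.
\<close>

class complex_hilbert_space = banach +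
  fixes scaleC :: "complex \<Rightarrow> 'a \<Rightarrow> 'a"  (infixr "*\<^sub>C" 75)
    and cinner :: "'a \<Rightarrow> 'a \<Rightarrow> complex"
  assumes scaleC_add_right: "c *\<^sub>C (x + y) = c *\<^sub>C x + c *\<^sub>C y"
    and scaleC_add_left: "(b + c) *\<^sub>C x = b *\<^sub>C x + c *\<^sub>C x"
    and scaleC_scaleC: "b *\<^sub>C (c *\<^sub>C x) = (b * c) *\<^sub>C x"
    and scaleC_one: "1 *\<^sub>C x = x"
    and scaleR_scaleC: "scaleR r x = complex_of_real r *\<^sub>C x"
    and cinner_commute: "cinner x y = cnj (cinner y x)"
    and cinner_add_left: "cinner (x + y) z = cinner x z + cinner y z"
    and cinner_scaleC_left: "cinner (c *\<^sub>C x) y = c * cinner x y"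
    and cinner_self_nonneg: "0 \<le> Re (cinner x x)"
    and cinner_self_eq_zero: "cinner x x = 0 \<longleftrightarrow> x = 0"
    and norm_eq_sqrt_cinner: "norm x = sqrt (Re (cinner x x))"

instantiation complex :: complex_hilbert_space
begin

definition scaleC_complex :: "complex \<Rightarrow> complex \<Rightarrow> complex"
  where "scaleC_complex c x = c * x"

definition cinner_complex :: "complex \<Rightarrow> complex \<Rightarrow> complex"
  where "cinner_complex x y = x * cnj y"

instance
proof
  fix x :: complex
  show "norm x = sqrt (Re (cinner x x))"
    by (simp add: cinner_complex_def cmod_def power2_eq_square)
qed (auto simp: scaleC_complex_def cinner_complex_def algebra_simps scaleR_conv_of_real)

end

definition bounded_clinear :: "('a::complex_hilbert_space \<Rightarrow> 'a) \<Rightarrow> bool"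
  where "bounded_clinear U \<longleftrightarrow> bounded_linear U \<and> (\<forall>c x. U (c *\<^sub>C x) = c *\<^sub>C U x)"

definition is_adjoint :: "('a::complex_hilbert_space \<Rightarrow> 'a) \<Rightarrow> ('a \<Rightarrow> 'a) \<Rightarrow> bool"
  where "is_adjoint U W \<longleftrightarrow> (\<forall>x y. cinner (U x) y = cinner x (W y))"

definition unitary :: "('a::complex_hilbert_space \<Rightarrow> 'a) \<Rightarrow> bool"
  where "unitary U \<longleftrightarrow> bounded_clinear U \<and> (\<exists>W. is_adjoint U W \<and> W \<circ> U = id \<and> U \<circ> W = id)"

text \<open>Integer powers of an invertible operator.\<close>

definition op_powi :: "('a \<Rightarrow> 'a) \<Rightarrow> int \<Rightarrow> 'a \<Rightarrow> 'a"
  where "op_powi U k = (if 0 \<le> k then U ^^ nat k else inv U ^^ nat (- k))"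

text \<open>
  A trigonometric polynomial of degree at most \<open>d\<close> is given by its coefficients \<open>a k\<close> for
  \<open>\<bar>k\<bar> \<le> d\<close>; the values of \<open>a\<close> at other indices are irrelevant.
\<close>

definition trig_poly :: "nat \<Rightarrow> (int \<Rightarrow> complex) \<Rightarrow> complex \<Rightarrow> complex"
  where "trig_poly d a \<zeta> = (\<Sum>k = - int d..int d. a k * \<zeta> powi k)"

definition trig_poly_op ::
    "nat \<Rightarrow> (int \<Rightarrow> complex) \<Rightarrow> ('a::complex_hilbert_space \<Rightarrow> 'a) \<Rightarrow> 'a \<Rightarrow> 'a"
  where "trig_poly_op d a U x = (\<Sum>k = - int d..int d. a k *\<^sub>C op_powi U k x)"

end

(*
  By scaling we may assume |f| < 1 on the circle. The Fejer-Riesz theorem gives a trigonometric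
  polynomial g of degree at most d with |f|^2 + |g|^2 = 1, and the column (f, g) is factored into
  2x2 matrix-valued trigonometric polynomials of degree 1, each of the form
    R diag(z, 1) S diag(1, 1/z)
  with rotations R and S, applied to a constant unit vector. Evaluated at a unitary U, every factor
  is an isometry of H x H, and evaluated at U and V it differs by R applied to the diagonal operator
  with entries s (U - V) and cnj s (inv U - inv V), where |s| <= 1, whose norm is at most |U - V|.
  Telescoping over the d factors gives the bound d |U - V|.
*)

theory Submission
  imports Defs "HOL-Computational_Algebra.Fundamental_Theorem_Algebra"
begin

section \<open>Polynomials on the unit circle\<close>

text \<open>The circle is connected and contains both 1 and -1, whereas a finite connected set has
  at most one point.\<close>

lemma infinite_unit_circle: "infinite {z :: complex. norm z = 1}"
proof -
  have "connected (sphere (0::complex) 1)"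
    by (rule connected_sphere) simp
  moreover have "1 \<in> sphere (0::complex) 1" "- 1 \<in> sphere (0::complex) 1"
    by auto
  moreover have "1 \<noteq> (- 1 :: complex)"
    by simp
  ultimately have "infinite (sphere (0::complex) 1)"
    unfolding connected_finite_iff_sing[OF \<open>connected _\<close>] by (metis empty_iff singletonD)
  moreover have "sphere (0::complex) 1 = {z. norm z = 1}"
    by auto
  ultimately show ?thesis
    by simp
qed

text \<open>A nonzero polynomial has finitely many roots. This turns identities on the circle into
  identities between coefficients.\<close>

lemma poly_eqI_circle:
  fixes p q :: "complex poly"
  assumes "\<And>z. norm z = 1 \<Longrightarrow> poly p z = poly q z"
  shows "p = q"
proof -
  have "{z. norm z = 1} \<subseteq> {z. poly (p - q) z = 0}"
    using assms by auto
  then have "infinite {z. poly (p - q) z = 0}"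
    using infinite_unit_circle infinite_super by blast
  then show ?thesis
    using poly_roots_finite[of "p - q"] by auto
qed

lemma complex_mult_cnj_cmod: "z * cnj z = of_real ((norm z)\<^sup>2)"
  by (rule complex_norm_square[symmetric])

text \<open>For \<open>degree p \<le> n\<close> this is the reciprocal polynomial
  \<open>z ^ n * cnj (poly p (1 / cnj z))\<close>. The length \<open>n\<close> is a parameter
  because top coefficients of \<open>p\<close> may vanish.\<close>

definition conj_reflect :: "nat \<Rightarrow> complex poly \<Rightarrow> complex poly"
  where "conj_reflect n p = (\<Sum>i\<le>n. monom (cnj (coeff p (n - i))) i)"

lemma coeff_conj_reflect:
  "coeff (conj_reflect n p) k = (if k \<le> n then cnj (coeff p (n - k)) else 0)"
  by (auto simp: conj_reflect_def coeff_sum sum.delta)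

lemma degree_conj_reflect_le: "degree (conj_reflect n p) \<le> n"
  by (rule degree_le) (auto simp: coeff_conj_reflect)

lemma poly_eq_sum_le:
  fixes p :: "'a::comm_semiring_1 poly"
  assumes "degree p \<le> n"
  shows "poly p x = (\<Sum>i\<le>n. coeff p i * x ^ i)"
  unfolding poly_altdef
  by (rule sum.mono_neutral_left) (use assms in \<open>auto simp: coeff_eq_0\<close>)

lemma poly_conj_reflect:
  assumes "degree p \<le> n" and "w \<noteq> 0"
  shows "poly (conj_reflect n p) w = w ^ n * cnj (poly p (1 / cnj w))"
proof -
  have "poly (conj_reflect n p) w = (\<Sum>i\<le>n. cnj (coeff p (n - i)) * w ^ i)"
    by (simp add: conj_reflect_def poly_sum poly_monom)
  also have "\<dots> = (\<Sum>i\<le>n. cnj (coeff p i) * w ^ (n - i))"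
    by (rule sum.reindex_bij_witness[of _ "\<lambda>i. n - i" "\<lambda>i. n - i"]) auto
  also have "\<dots> = (\<Sum>i\<le>n. w ^ n * (cnj (coeff p i) * (1 / w) ^ i))"
    by (rule sum.cong) (use assms in \<open>auto simp: power_diff power_divide\<close>)
  also have "\<dots> = w ^ n * cnj (poly p (1 / cnj w))"
    by (simp add: poly_eq_sum_le[OF assms(1)] sum_distrib_left)
  finally show ?thesis .
qed

lemma cnj_inverse_circle: "norm z = 1 \<Longrightarrow> 1 / cnj z = z"
  by (auto simp: divide_eq_eq complex_mult_cnj_cmod)

lemma poly_conj_reflect_circle:
  assumes "degree p \<le> n" and "norm z = 1"
  shows "poly (conj_reflect n p) z = z ^ n * cnj (poly p z)"
proof -
  have "z \<noteq> 0" using assms(2) by auto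
  then show ?thesis
    using poly_conj_reflect[OF assms(1)] cnj_inverse_circle[OF assms(2)] by simp
qed

lemma degree_le_of_coeff_top_zero:
  assumes "degree p \<le> Suc n" and "coeff p (Suc n) = 0"
  shows "degree p \<le> n"
proof (rule degree_le, intro allI impI)
  fix i assume "n < i"
  then show "coeff p i = 0"
    using assms by (cases "i = Suc n") (auto simp: coeff_eq_0)
qed

text \<open>If \<open>i \<noteq> n\<close>, then \<open>i\<close> or \<open>n + n - i\<close>
  exceeds \<open>n\<close>, so a single term of the convolution survives.\<close>

lemma coeff_mult_double:
  fixes p q :: "'a::comm_semiring_0 poly"
  assumes "degree p \<le> n" and "degree q \<le> n"
  shows "coeff (p * q) (n + n) = coeff p n * coeff q n"
proof -
  have "coeff (p * q) (n + n) = (\<Sum>i\<le>n + n. coeff p i * coeff q (n + n - i))"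
    by (simp add: coeff_mult)
  also have "\<dots> = (\<Sum>i\<in>{n}. coeff p i * coeff q (n + n - i))"
  proof (rule sum.mono_neutral_right)
    show "\<forall>i\<in>{..n + n} - {n}. coeff p i * coeff q (n + n - i) = 0"
    proof
      fix i assume "i \<in> {..n + n} - {n}"
      then have "degree p < i \<or> degree q < n + n - i" using assms by auto
      then show "coeff p i * coeff q (n + n - i) = 0" by (auto simp: coeff_eq_0)
    qed
  qed auto
  finally show ?thesis by simp
qed

text \<open>Multiplied by \<open>z ^ n\<close>, the condition on the circle becomes a polynomial
  identity with right-hand side \<open>monom 1 n\<close>. Its coefficient at \<open>n + n\<close> is
  the inner product in question.\<close>

lemma extreme_coeffs_orthogonal:
  fixes p q :: "complex poly"
  assumes deg: "degree p \<le> n" "degree q \<le> n" and "0 < n"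
    and unit: "\<And>z. norm z = 1 \<Longrightarrow> (norm (poly p z))\<^sup>2 + (norm (poly q z))\<^sup>2 = 1"
  shows "coeff p n * cnj (coeff p 0) + coeff q n * cnj (coeff q 0) = 0"
proof -
  have "p * conj_reflect n p + q * conj_reflect n q = monom 1 n"
  proof (rule poly_eqI_circle)
    fix z :: complex assume z: "norm z = 1"
    have "poly (p * conj_reflect n p + q * conj_reflect n q) z
        = z ^ n * (poly p z * cnj (poly p z) + poly q z * cnj (poly q z))"
      by (simp add: poly_conj_reflect_circle deg z algebra_simps)
    also have "poly p z * cnj (poly p z) + poly q z * cnj (poly q z) = 1"
      using unit[OF z] by (simp add: complex_mult_cnj_cmod flip: of_real_add of_real_power)
    finally show "poly (p * conj_reflect n p + q * conj_reflect n q) z = poly (monom 1 n) z"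
      by (simp add: poly_monom)
  qed
  then have "coeff (p * conj_reflect n p + q * conj_reflect n q) (n + n) = 0"
    using \<open>0 < n\<close> by simp
  then show ?thesis
    by (simp add: coeff_mult_double deg degree_conj_reflect_le coeff_conj_reflect)
qed

section \<open>The Fejer-Riesz factorization\<close>

text \<open>On the circle \<open>cnj z\<close> inverts \<open>z\<close>, so
  \<open>1 - cnj a * z\<close> is \<open>z * cnj (z - a)\<close>.\<close>

lemma circle_quadratic:
  assumes "norm z = 1"
  shows "(z - a) * (1 - cnj a * z) = z * of_real ((norm (z - a))\<^sup>2)"
proof -
  have "z * cnj z = 1"
    using assms by (simp add: complex_mult_cnj_cmod)
  then have "1 - cnj a * z = z * cnj (z - a)"
    by (simp add: right_diff_distrib mult.commute)
  then show ?thesis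
    unfolding complex_mult_cnj_cmod[symmetric] by (simp only: mult.left_commute)
qed

text \<open>Since \<open>h\<close> is real, reflection sends \<open>z ^ n * h z\<close> to
  \<open>z ^ (2 * n) * cnj z ^ n * h z\<close>, the same value on the circle.\<close>

lemma conj_reflect_positive:
  fixes p :: "complex poly"
  assumes "degree p \<le> 2 * n"
    and "\<And>z. norm z = 1 \<Longrightarrow> poly p z = z ^ n * of_real (h z)"
  shows "conj_reflect (2 * n) p = p"
proof (rule poly_eqI_circle)
  fix z :: complex assume z: "norm z = 1"
  have "z * cnj z = 1"
    using z by (simp add: complex_mult_cnj_cmod)
  then have "z ^ n * cnj z ^ n = 1"
    by (metis power_mult_distrib power_one)
  moreover have "poly (conj_reflect (2 * n) p) z = z ^ n * (z ^ n * cnj z ^ n) * of_real (h z)"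
    using assms z by (simp add: poly_conj_reflect_circle mult_2 power_add)
  ultimately show "poly (conj_reflect (2 * n) p) z = poly p z"
    using assms z by simp
qed

text \<open>
  The zeros of \<open>z\<^sup>n h(z)\<close> come in pairs \<open>a\<close>, \<open>1 / cnj a\<close> off the circle, and the product of the two
  corresponding linear factors is \<open>z \<bar>z - a\<bar>\<^sup>2\<close> on the circle up to a constant.
\<close>

lemma fejer_riesz:
  fixes p :: "complex poly" and h :: "complex \<Rightarrow> real"
  assumes "degree p \<le> 2 * n"
    and "\<And>z. norm z = 1 \<Longrightarrow> poly p z = z ^ n * of_real (h z)"
    and "\<And>z. norm z = 1 \<Longrightarrow> 0 < h z"
  shows "\<exists>q. degree q \<le> n \<and> (\<forall>z. norm z = 1 \<longrightarrow> (norm (poly q z))\<^sup>2 = h z)"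
  using assms
proof (induction n arbitrary: p h)
  case 0
  \<comment> \<open>Here \<open>p\<close> is constant, hence \<open>h\<close> is constant on the
    circle, and its square root serves as \<open>q\<close>.\<close>
  define c where "c = h 1"
  have "degree p = 0" using 0(1) by simp
  then obtain a where "p = [:a:]" by (rule degree_eq_zeroE)
  then have p: "poly p z = poly p 1" for z
    by simp
  have "h z = c" if "norm z = 1" for z
    using 0(2)[of z] 0(2)[of 1] p[of z] that by (simp add: c_def)
  moreover have "0 < c" using 0(3)[of 1] by (simp add: c_def)
  ultimately have "\<forall>z. norm z = 1 \<longrightarrow> (norm (poly [:of_real (sqrt c):] z))\<^sup>2 = h z"
    by simp
  then show ?case
    by (intro exI[of _ "[:of_real (sqrt c):]"]) auto
next
  case (Suc n)
  \<comment> \<open>By this symmetry the extreme coefficients vanish together, and the nonzero roots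
    are invariant under \<open>a\<close> to \<open>1 / cnj a\<close>.\<close>
  have sym: "conj_reflect (2 * Suc n) p = p"
    using Suc.prems by (intro conj_reflect_positive) auto
  show ?case
  proof (cases "coeff p 0 = 0")
    \<comment> \<open>A root at the origin goes with a vanishing top coefficient, so dividing by the
      variable lowers the degree bound by two.\<close>
    case True
    then obtain r where r: "p = pCons 0 r"
      by (metis coeff_pCons_0 pCons_cases)
    have "coeff p (2 * Suc n) = 0"
      using True by (subst sym[symmetric]) (simp add: coeff_conj_reflect)
    then have "degree p \<le> Suc (2 * n)"
      using Suc.prems(1) degree_le_of_coeff_top_zero[of p "Suc (2 * n)"] by simp
    then have "degree r \<le> 2 * n"
      unfolding r by (auto simp: degree_pCons_eq_if split: if_splits)
    moreover have "poly r z = z ^ n * of_real (h z)" if "norm z = 1" for z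
    proof -
      have "z \<noteq> 0" using that by auto
      moreover have "z * poly r z = z * (z ^ n * of_real (h z))"
        using Suc.prems(2)[OF that] by (simp add: r)
      ultimately show ?thesis by simp
    qed
    ultimately obtain q where "degree q \<le> n" "\<forall>z. norm z = 1 \<longrightarrow> (norm (poly q z))\<^sup>2 = h z"
      using Suc.IH[of r h] Suc.prems(3) by blast
    then show ?thesis by (meson le_SucI)
  next
    case False
    have "coeff p (2 * Suc n) \<noteq> 0"
      using False by (subst sym[symmetric]) (simp add: coeff_conj_reflect)
    then have "degree p \<noteq> 0"
      using le_degree[of p "2 * Suc n"] by simp
    then obtain a where a: "poly p a = 0"
      using fundamental_theorem_of_algebra[of p] by (auto simp: constant_degree)
    have "a \<noteq> 0" using a False by (auto simp: poly_0_coeff_0)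
    \<comment> \<open>A root on the circle would contradict the positivity of
      \<open>h\<close>.\<close>
    have "norm a \<noteq> 1"
      using a Suc.prems(2)[of a] Suc.prems(3)[of a] \<open>a \<noteq> 0\<close> by auto
    define b where "b = 1 / cnj a"
    have "b \<noteq> 0" using \<open>a \<noteq> 0\<close> by (simp add: b_def)
    \<comment> \<open>Evaluated at \<open>b\<close>, the reflection of \<open>p\<close> involves
      \<open>p\<close> at \<open>1 / cnj b\<close>, which is \<open>a\<close>.\<close>
    have "poly p b = 0"
      using poly_conj_reflect[OF Suc.prems(1) \<open>b \<noteq> 0\<close>] a sym by (simp add: b_def)
    have "b \<noteq> a"
    proof
      assume "b = a"
      then have "a * cnj a = 1"
        using \<open>a \<noteq> 0\<close> by (simp add: b_def field_simps)
      then have "(norm a)\<^sup>2 = 1"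
        by (simp only: complex_mult_cnj_cmod of_real_eq_1_iff)
      then show False
        using \<open>norm a \<noteq> 1\<close> norm_ge_zero[of a] by (auto simp: power2_eq_1_iff)
    qed
    obtain s where s: "p = [:-a, 1:] * s" using a by (auto simp: poly_eq_0_iff_dvd)
    have "poly s b = 0" using \<open>poly p b = 0\<close> \<open>b \<noteq> a\<close> by (simp add: s)
    then obtain t where t: "s = [:-b, 1:] * t" by (auto simp: poly_eq_0_iff_dvd)
    \<comment> \<open>The constant comes from \<open>z - b = - b * (1 - cnj a * z)\<close>, which
      puts the pair of factors into the form of \<open>circle_quadratic\<close>.\<close>
    define r where "r = smult (- b) t"
    have b_factor: "[:-b, 1:] = smult (- b) [:1, - cnj a:]"
      using \<open>a \<noteq> 0\<close> by (simp add: b_def)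
    then have p: "p = [:-a, 1:] * ([:1, - cnj a:] * r)"
      unfolding s t r_def b_factor by (simp only: mult_smult_left mult_smult_right)
    have "p \<noteq> 0" using False by auto
    then have "r \<noteq> 0" by (auto simp: p)
    have "degree p = 2 + degree r"
    proof -
      have "[:-a, 1:] \<noteq> 0" "[:1, - cnj a:] \<noteq> 0" by auto
      then have "degree p = degree [:-a, 1:] + (degree [:1, - cnj a:] + degree r)"
        unfolding p using \<open>r \<noteq> 0\<close> by (simp only: degree_mult_eq mult_eq_0_iff simp_thms)
      then show ?thesis using \<open>a \<noteq> 0\<close> by simp
    qed
    then have "degree r \<le> 2 * n" using Suc.prems(1) by simp
    moreover have za: "z \<noteq> a" if "norm z = 1" for z
      using that \<open>norm a \<noteq> 1\<close> by auto
    moreover have "poly r z = z ^ n * of_real (h z / (norm (z - a))\<^sup>2)" if "norm z = 1" for z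
    proof -
      have "z \<noteq> 0" using that by auto
      have "poly p z = (z - a) * (1 - cnj a * z) * poly r z"
        by (simp add: p algebra_simps)
      then have "z * of_real ((norm (z - a))\<^sup>2) * poly r z = z * (z ^ n * of_real (h z))"
        using Suc.prems(2)[OF that] circle_quadratic[OF that, of a]
        by (metis mult.assoc power_Suc)
      then have "of_real ((norm (z - a))\<^sup>2) * poly r z = z ^ n * of_real (h z)"
        using \<open>z \<noteq> 0\<close> by (simp only: mult.assoc mult_cancel_left simp_thms)
      then show ?thesis
        using za[OF that] by (simp add: field_simps)
    qed
    ultimately obtain q where q: "degree q \<le> n"
        "\<forall>z. norm z = 1 \<longrightarrow> (norm (poly q z))\<^sup>2 = h z / (norm (z - a))\<^sup>2"
      using Suc.IH[of r "\<lambda>z. h z / (norm (z - a))\<^sup>2"] Suc.prems(3) by auto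
    have "degree ([:-a, 1:] * q) \<le> Suc n"
      using degree_mult_le[of "[:-a, 1:]" q] q(1) by simp
    moreover have "(norm (poly ([:-a, 1:] * q) z))\<^sup>2 = h z" if "norm z = 1" for z
    proof -
      have "poly ([:-a, 1:] * q) z = (z - a) * poly q z" by (simp add: algebra_simps)
      then show ?thesis
        using q(2) that za[OF that] by (simp add: norm_mult power_mult_distrib)
    qed
    ultimately show ?thesis by blast
  qed
qed

text \<open>Fejer-Riesz applied to \<open>1 - (norm (poly p z))^2\<close>, which is positive by the
  strict bound; times \<open>z ^ n\<close> it agrees on the circle with the polynomial
  \<open>P\<close>.\<close>

lemma complementary_poly:
  fixes p :: "complex poly"
  assumes "degree p \<le> n" and "\<And>z. norm z = 1 \<Longrightarrow> norm (poly p z) < 1"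
  obtains q where "degree q \<le> n"
    and "\<And>z. norm z = 1 \<Longrightarrow> (norm (poly p z))\<^sup>2 + (norm (poly q z))\<^sup>2 = 1"
proof -
  define P where "P = monom 1 n - p * conj_reflect n p"
  have "degree P \<le> 2 * n"
    unfolding P_def
  proof (rule degree_diff_le)
    show "degree (monom 1 n :: complex poly) \<le> 2 * n"
      by (simp add: degree_monom_eq)
    show "degree (p * conj_reflect n p) \<le> 2 * n"
      using degree_mult_le[of p "conj_reflect n p"] degree_conj_reflect_le[of n p] assms(1)
      by linarith
  qed
  moreover have "poly P z = z ^ n * of_real (1 - (norm (poly p z))\<^sup>2)" if "norm z = 1" for z
  proof -
    have "poly P z = z ^ n * (1 - poly p z * cnj (poly p z))"
      by (simp add: P_def poly_monom poly_conj_reflect_circle assms(1) that algebra_simps)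
    then show ?thesis by (simp add: complex_mult_cnj_cmod)
  qed
  moreover have "0 < 1 - (norm (poly p z))\<^sup>2" if "norm z = 1" for z
    using assms(2)[OF that] by (simp add: power_less_one_iff abs_square_less_1)
  ultimately obtain q where "degree q \<le> n"
    "\<forall>z. norm z = 1 \<longrightarrow> (norm (poly q z))\<^sup>2 = 1 - (norm (poly p z))\<^sup>2"
    using fejer_riesz[of P n "\<lambda>z. 1 - (norm (poly p z))\<^sup>2"] by blast
  then show ?thesis by (intro that[of q]) auto
qed

section \<open>Complex Hilbert spaces\<close>

lemma cinner_add_right:
  fixes x :: "'a::complex_hilbert_space"
  shows "cinner x (y + z) = cinner x y + cinner x z"
  by (metis cinner_add_left cinner_commute complex_cnj_add)

lemma cinner_scaleC_right:
  fixes x :: "'a::complex_hilbert_space"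
  shows "cinner x (c *\<^sub>C y) = cnj c * cinner x y"
  by (metis cinner_commute cinner_scaleC_left complex_cnj_mult)

lemma cinner_self:
  fixes x :: "'a::complex_hilbert_space"
  shows "cinner x x = of_real ((norm x)\<^sup>2)"
proof -
  have "Im (cinner x x) = 0"
    by (metis cinner_commute cnj.simps(2) equal_neg_zero)
  then show ?thesis
    by (simp add: norm_eq_sqrt_cinner cinner_self_nonneg complex_eq_iff)
qed

lemma norm_scaleC:
  fixes x :: "'a::complex_hilbert_space"
  shows "norm (c *\<^sub>C x) = norm c * norm x"
proof -
  have "complex_of_real ((norm (c *\<^sub>C x))\<^sup>2) = (c * cnj c) * cinner x x"
    by (simp only: cinner_self[symmetric] cinner_scaleC_left cinner_scaleC_right mult.assoc
        mult.left_commute[of "cnj c"])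
  also have "\<dots> = of_real ((norm c * norm x)\<^sup>2)"
    by (simp add: cinner_self complex_mult_cnj_cmod power_mult_distrib)
  finally have "(norm (c *\<^sub>C x))\<^sup>2 = (norm c * norm x)\<^sup>2"
    by (simp only: of_real_eq_iff)
  then show ?thesis by simp
qed

lemma scaleC_zero_left: "0 *\<^sub>C (x::'a::complex_hilbert_space) = 0"
  by (metis norm_scaleC mult_zero_left norm_eq_zero norm_zero)

lemma scaleC_zero_right: "c *\<^sub>C (0::'a::complex_hilbert_space) = 0"
  by (metis norm_scaleC mult_zero_right norm_eq_zero norm_zero)

lemma scaleC_minus_left: "(- c) *\<^sub>C (x::'a::complex_hilbert_space) = - (c *\<^sub>C x)"
  by (metis add.right_inverse scaleC_add_left minus_unique scaleC_zero_left)

lemma scaleC_diff_right: "c *\<^sub>C (x - y) = c *\<^sub>C x - c *\<^sub>C (y::'a::complex_hilbert_space)"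
  by (metis add_diff_cancel diff_add_cancel scaleC_add_right)

lemma scaleC_sum_right:
  "c *\<^sub>C (\<Sum>i\<in>A. g i) = (\<Sum>i\<in>A. c *\<^sub>C (g i :: 'a::complex_hilbert_space))"
  by (induction A rule: infinite_finite_induct) (auto simp: scaleC_zero_right scaleC_add_right)

section \<open>Scalar rotations of pairs of vectors\<close>

definition rotate_pair ::
    "complex \<Rightarrow> complex \<Rightarrow> 'a::complex_hilbert_space \<times> 'a \<Rightarrow> 'a \<times> 'a"
  where "rotate_pair \<alpha> \<beta> = (\<lambda>(x, y). (\<alpha> *\<^sub>C x - cnj \<beta> *\<^sub>C y, \<beta> *\<^sub>C x + cnj \<alpha> *\<^sub>C y))"

lemma rotate_pair_diff:
  "rotate_pair \<alpha> \<beta> v - rotate_pair \<alpha> \<beta> w = rotate_pair \<alpha> \<beta> (v - w)"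
  by (cases v; cases w) (simp add: rotate_pair_def scaleC_diff_right)

text \<open>The matrix with rows \<open>(\<alpha>, - cnj \<beta>)\<close> and
  \<open>(\<beta>, cnj \<alpha>)\<close> is unitary: the cross terms of the two squared norms
  cancel.\<close>

lemma norm_rotate_pair:
  assumes "(norm \<alpha>)\<^sup>2 + (norm \<beta>)\<^sup>2 = 1"
  shows "norm (rotate_pair \<alpha> \<beta> v) = norm v"
proof -
  obtain x y where v: "v = (x, y)" by (cases v)
  have ab: "\<alpha> * cnj \<alpha> + \<beta> * cnj \<beta> = 1"
    using assms by (simp add: complex_mult_cnj_cmod flip: of_real_add of_real_power)
  define u where "u = \<alpha> *\<^sub>C x + (- cnj \<beta>) *\<^sub>C y"
  define w where "w = \<beta> *\<^sub>C x + cnj \<alpha> *\<^sub>C y"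
  have "cinner u u + cinner w w = (\<alpha> * cnj \<alpha> + \<beta> * cnj \<beta>) * (cinner x x + cinner y y)"
    unfolding u_def w_def
    by (simp only: cinner_add_left cinner_add_right cinner_scaleC_left cinner_scaleC_right
        complex_cnj_minus complex_cnj_cnj) (simp add: algebra_simps)
  then have "complex_of_real ((norm u)\<^sup>2 + (norm w)\<^sup>2) = of_real ((norm x)\<^sup>2 + (norm y)\<^sup>2)"
    by (simp add: ab cinner_self)
  then have "(norm u)\<^sup>2 + (norm w)\<^sup>2 = (norm x)\<^sup>2 + (norm y)\<^sup>2"
    by (simp only: of_real_eq_iff)
  moreover have "rotate_pair \<alpha> \<beta> v = (u, w)"
    by (simp add: v rotate_pair_def u_def w_def scaleC_minus_left)
  ultimately show ?thesis
    by (simp add: v norm_Pair)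
qed

section \<open>Layer stripping\<close>

text \<open>The unit vector \<open>(\<alpha>, \<beta>)\<close> is to be parallel to
  \<open>(a, b)\<close> and orthogonal to \<open>(c, d)\<close>; \<open>orth\<close> makes the two
  demands compatible.\<close>

lemma exists_stripping_direction:
  fixes a b c d :: complex
  assumes orth: "a * cnj c + b * cnj d = 0"
  obtains (direction) \<alpha> \<beta> where "(norm \<alpha>)\<^sup>2 + (norm \<beta>)\<^sup>2 = 1"
    and "\<alpha> * b = \<beta> * a" and "cnj \<alpha> * c + cnj \<beta> * d = 0"
proof -
  \<comment> \<open>Both conditions survive division by a positive real, so any nonzero solution
    suffices.\<close>
  have normalize: thesis if "(u, v) \<noteq> (0, 0)" "u * b = v * a" "cnj u * c + cnj v * d = 0" for u v
  proof -
    define s where "s = sqrt ((norm u)\<^sup>2 + (norm v)\<^sup>2)"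
    have s: "0 < (norm u)\<^sup>2 + (norm v)\<^sup>2"
      using that(1) by (auto simp: add_pos_nonneg add_nonneg_pos)
    then have s0: "0 < s" and s2: "s\<^sup>2 = (norm u)\<^sup>2 + (norm v)\<^sup>2"
      by (auto simp: s_def)
    show thesis
    proof (rule direction)
      show "(norm (u / of_real s))\<^sup>2 + (norm (v / of_real s))\<^sup>2 = 1"
        using s0 by (simp add: norm_divide power_divide s2[symmetric] flip: add_divide_distrib)
      show "u / of_real s * b = v / of_real s * a"
        using that(2) by simp
      have "cnj (u / of_real s) * c + cnj (v / of_real s) * d = (cnj u * c + cnj v * d) / of_real s"
        by (simp add: add_divide_distrib)
      then show "cnj (u / of_real s) * c + cnj (v / of_real s) * d = 0"
        by (simp add: that(3))
    qed
  qed
  show thesis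
  proof (cases "a = 0 \<and> b = 0")
    case False
    have "cnj a * c + cnj b * d = 0"
      using arg_cong[OF orth, of cnj] by (simp add: mult.commute)
    then show ?thesis using False by (intro normalize[of a b]) (auto simp: mult.commute)
  next
    case True
    show ?thesis
    proof (cases "c = 0 \<and> d = 0")
      case True
      then show ?thesis using \<open>a = 0 \<and> b = 0\<close> by (intro normalize[of 1 0]) auto
    next
      case False
      \<comment> \<open>With \<open>(a, b)\<close> zero only orthogonality to \<open>(c, d)\<close>
        remains.\<close>
      then show ?thesis using \<open>a = 0 \<and> b = 0\<close>
        by (intro normalize[of "cnj d" "- cnj c"]) (auto simp: mult.commute)
    qed
  qed
qed

text \<open>
  The top and bottom coefficients of \<open>(p, q)\<close> are orthogonal vectors of \<open>\<complex>\<^sup>2\<close>. After a rotation that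
  makes the top one a multiple of \<open>(1, 0)\<close> and the bottom one a multiple of \<open>(0, 1)\<close>, the first
  polynomial is divisible by the variable and the second one has dropped in degree.
\<close>

lemma strip_layer:
  fixes p q :: "complex poly"
  assumes deg: "degree p \<le> Suc n" "degree q \<le> Suc n"
    and unit: "\<And>z. norm z = 1 \<Longrightarrow> (norm (poly p z))\<^sup>2 + (norm (poly q z))\<^sup>2 = 1"
  obtains \<alpha> \<beta> p' q' where "(norm \<alpha>)\<^sup>2 + (norm \<beta>)\<^sup>2 = 1"
    and "degree p' \<le> n" and "degree q' \<le> n"
    and "\<And>z. norm z = 1 \<Longrightarrow> (norm (poly p' z))\<^sup>2 + (norm (poly q' z))\<^sup>2 = 1"
    and "p = smult \<alpha> (pCons 0 p') + smult (- cnj \<beta>) q'"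
    and "q = smult \<beta> (pCons 0 p') + smult (cnj \<alpha>) q'"
proof -
  have "coeff p (Suc n) * cnj (coeff p 0) + coeff q (Suc n) * cnj (coeff q 0) = 0"
    using extreme_coeffs_orthogonal[OF deg _ unit] by simp
  then obtain \<alpha> \<beta> where ab: "(norm \<alpha>)\<^sup>2 + (norm \<beta>)\<^sup>2 = 1"
    and top: "\<alpha> * coeff q (Suc n) = \<beta> * coeff p (Suc n)"
    and bot: "cnj \<alpha> * coeff p 0 + cnj \<beta> * coeff q 0 = 0"
    using exists_stripping_direction by metis
  have ab1: "\<alpha> * cnj \<alpha> + \<beta> * cnj \<beta> = 1"
    using ab by (simp add: complex_mult_cnj_cmod flip: of_real_add of_real_power)
  \<comment> \<open>\<open>P\<close> and \<open>q'\<close> are the components of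
    \<open>(p, q)\<close> under the inverse rotation. \<open>bot\<close> kills the constant
    coefficient of \<open>P\<close>, and \<open>top\<close> the coefficient of \<open>q'\<close> at
    \<open>Suc n\<close>.\<close>
  define P where "P = smult (cnj \<alpha>) p + smult (cnj \<beta>) q"
  define q' where "q' = smult \<alpha> q + smult (- \<beta>) p"
  have "coeff P 0 = 0" using bot by (simp add: P_def)
  then obtain p' where p': "P = pCons 0 p'"
    by (metis coeff_pCons_0 pCons_cases)
  have "degree P \<le> Suc n"
    unfolding P_def using deg by (intro degree_add_le order_trans[OF degree_smult_le])
  then have "degree p' \<le> n"
    by (auto simp: p' degree_pCons_eq_if split: if_splits)
  moreover have "degree q' \<le> n"
  proof (rule degree_le_of_coeff_top_zero)
    show "degree q' \<le> Suc n"
      unfolding q'_def using deg by (intro degree_add_le order_trans[OF degree_smult_le])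
    show "coeff q' (Suc n) = 0" using top by (simp add: q'_def)
  qed
  moreover have "p = smult \<alpha> P + smult (- cnj \<beta>) q'"
  proof -
    have "smult \<alpha> P + smult (- cnj \<beta>) q' = smult (\<alpha> * cnj \<alpha> + \<beta> * cnj \<beta>) p"
      by (simp add: P_def q'_def smult_add_right smult_diff_right smult_add_left algebra_simps)
    then show ?thesis by (simp add: ab1)
  qed
  moreover have "q = smult \<beta> P + smult (cnj \<alpha>) q'"
  proof -
    have "smult \<beta> P + smult (cnj \<alpha>) q' = smult (\<alpha> * cnj \<alpha> + \<beta> * cnj \<beta>) q"
      by (simp add: P_def q'_def smult_add_right smult_diff_right smult_add_left algebra_simps)
    then show ?thesis by (simp add: ab1)
  qed
  moreover have "(norm (poly p' z))\<^sup>2 + (norm (poly q' z))\<^sup>2 = 1" if z: "norm z = 1" for z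
  proof -
    have eqs: "poly p z = \<alpha> * poly P z - cnj \<beta> * poly q' z"
      "poly q z = \<beta> * poly P z + cnj \<alpha> * poly q' z"
      using \<open>p = _\<close> \<open>q = _\<close> by (metis (no_types) poly_add poly_smult minus_mult_left diff_conv_add_uminus)+
    \<comment> \<open>The values form a pair over the Hilbert space \<open>complex\<close>, so the
      rotation lemma for vectors applies.\<close>
    have "norm (poly p z, poly q z) = norm (rotate_pair \<alpha> \<beta> (poly P z, poly q' z))"
      by (simp add: eqs rotate_pair_def scaleC_complex_def)
    also have "\<dots> = norm (poly P z, poly q' z)"
      by (rule norm_rotate_pair[OF ab])
    finally have "(norm (poly P z))\<^sup>2 + (norm (poly q' z))\<^sup>2 = 1"
      using unit[OF z] by (simp add: norm_Pair)
    then show ?thesis by (simp add: p' norm_mult z)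
  qed
  ultimately show thesis
    by (intro that[of \<alpha> \<beta> p' q']) (auto simp: ab p')
qed

section \<open>Polynomials of isometries\<close>

text \<open>Treats a unitary, its inverse and their iterates uniformly.\<close>

definition clinear_isometry :: "('a::complex_hilbert_space \<Rightarrow> 'a) \<Rightarrow> bool"
  where "clinear_isometry T \<longleftrightarrow> (\<forall>x y. T (x + y) = T x + T y) \<and>
    (\<forall>c x. T (c *\<^sub>C x) = c *\<^sub>C T x) \<and> (\<forall>x. norm (T x) = norm x)"

lemma
  assumes "clinear_isometry T"
  shows clinear_isometry_add: "T (x + y) = T x + T y"
    and clinear_isometry_scaleC: "T (c *\<^sub>C x) = c *\<^sub>C T x"
    and clinear_isometry_norm: "norm (T x) = norm x"
    and clinear_isometry_diff: "T (x - y) = T x - T y"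
    and clinear_isometry_zero: "T 0 = 0"
proof -
  show add: "T (x + y) = T x + T y" for x y
    using assms by (simp add: clinear_isometry_def)
  show "T (c *\<^sub>C x) = c *\<^sub>C T x" "norm (T x) = norm x"
    using assms by (auto simp: clinear_isometry_def)
  show "T (x - y) = T x - T y"
    using add[of "x - y" y] by (simp add: algebra_simps)
  show "T 0 = 0" using add[of 0 0] by simp
qed

lemma clinear_isometry_sum:
  assumes "clinear_isometry T"
  shows "T (\<Sum>i\<in>A. g i) = (\<Sum>i\<in>A. T (g i))"
  by (induction A rule: infinite_finite_induct)
    (auto simp: clinear_isometry_zero[OF assms] clinear_isometry_add[OF assms])

lemma clinear_isometry_funpow: "clinear_isometry T \<Longrightarrow> clinear_isometry (T ^^ n)"
  by (induction n) (auto simp: clinear_isometry_def)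

text \<open>As \<open>W\<close> is both adjoint and inverse,
  \<open>cinner (U x) (U x) = cinner x (W (U x)) = cinner x x\<close>. Linearity and isometry then
  transfer to \<open>inv U\<close>.\<close>

lemma unitary_imp:
  fixes U :: "'a::complex_hilbert_space \<Rightarrow> 'a"
  assumes "unitary U"
  shows "bij U" and "clinear_isometry U" and "clinear_isometry (inv U)"
proof -
  obtain W where lin: "bounded_clinear U" and adj: "is_adjoint U W"
    and WU: "W \<circ> U = id" and UW: "U \<circ> W = id"
    using assms by (auto simp: unitary_def)
  show bij: "bij U" using WU UW by (rule o_bij)
  have add: "U (x + y) = U x + U y" and scale: "U (c *\<^sub>C x) = c *\<^sub>C U x" for x y c
    using lin by (auto simp: bounded_clinear_def linear_simps)
  have "cinner (U x) (U x) = cinner x x" for x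
    using adj WU by (simp add: is_adjoint_def) (metis comp_apply id_apply)
  then have norm: "norm (U x) = norm x" for x
    by (simp add: norm_eq_sqrt_cinner)
  show "clinear_isometry U" by (simp add: clinear_isometry_def add scale norm)
  have UV: "U (inv U x) = x" for x
    using bij by (simp add: bij_is_surj surj_f_inv_f)
  have VU: "inv U (U x) = x" for x
    using bij by (simp add: bij_is_inj)
  show "clinear_isometry (inv U)"
    unfolding clinear_isometry_def by (metis add scale norm UV VU)
qed

section \<open>Polynomials of a single operator\<close>

definition poly_op :: "complex poly \<Rightarrow> ('a::complex_hilbert_space \<Rightarrow> 'a) \<Rightarrow> 'a \<Rightarrow> 'a"
  where "poly_op p T x = (\<Sum>i\<le>degree p. coeff p i *\<^sub>C (T ^^ i) x)"

lemma poly_op_eq_sum_le: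
  assumes "degree p \<le> n"
  shows "poly_op p T x = (\<Sum>i\<le>n. coeff p i *\<^sub>C (T ^^ i) x)"
  unfolding poly_op_def
  by (rule sum.mono_neutral_left) (use assms in \<open>auto simp: coeff_eq_0 scaleC_zero_left\<close>)

lemma poly_op_add: "poly_op (p + q) T x = poly_op p T x + poly_op q T x"
proof -
  define n where "n = max (degree p) (degree q)"
  have "degree p \<le> n" "degree q \<le> n" "degree (p + q) \<le> n"
    by (auto simp: n_def degree_add_le_max)
  then show ?thesis
    by (simp add: poly_op_eq_sum_le[of _ n] scaleC_add_left sum.distrib)
qed

lemma poly_op_smult: "poly_op (smult c p) T x = c *\<^sub>C poly_op p T x"
  unfolding poly_op_eq_sum_le[OF degree_smult_le]
  by (simp add: poly_op_def scaleC_sum_right scaleC_scaleC)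

lemma poly_op_pCons_0:
  assumes "clinear_isometry T"
  shows "poly_op (pCons 0 p) T x = T (poly_op p T x)"
proof -
  have "poly_op (pCons 0 p) T x = (\<Sum>i\<le>Suc (degree p). coeff (pCons 0 p) i *\<^sub>C (T ^^ i) x)"
    by (rule poly_op_eq_sum_le) (simp add: degree_pCons_le)
  also have "\<dots> = (\<Sum>i\<le>degree p. coeff p i *\<^sub>C T ((T ^^ i) x))"
    by (subst sum.atMost_Suc_shift) (simp add: scaleC_zero_left)
  also have "\<dots> = T (poly_op p T x)"
    by (simp add: poly_op_def clinear_isometry_sum[OF assms] clinear_isometry_scaleC[OF assms])
  finally show ?thesis .
qed

lemma poly_op_const: "degree p = 0 \<Longrightarrow> poly_op p T x = coeff p 0 *\<^sub>C x"
  by (simp add: poly_op_def)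

text \<open>\<open>poly_op\<close> is linear in the polynomial and turns multiplication by the
  variable into \<open>T\<close>, so the scalar factorization passes to operators.\<close>

lemma poly_op_layer:
  assumes "clinear_isometry T"
    and "p = smult \<alpha> (pCons 0 p') + smult (- cnj \<beta>) q'"
    and "q = smult \<beta> (pCons 0 p') + smult (cnj \<alpha>) q'"
  shows "(poly_op p T x, poly_op q T x)
    = rotate_pair \<alpha> \<beta> (T (poly_op p' T x), poly_op q' T x)"
  by (simp add: assms(2,3) rotate_pair_def poly_op_add poly_op_smult scaleC_minus_left
      poly_op_pCons_0[OF assms(1)] del: smult_pCons smult_minus_left)

text \<open>Each stripped layer is \<open>T\<close> on one component followed by a rotation, both
  isometric; at degree 0 a constant unit column remains.\<close>

lemma norm_poly_op_pair:
  assumes "clinear_isometry T"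
    and "degree p \<le> n" "degree q \<le> n"
    and "\<And>z. norm z = 1 \<Longrightarrow> (norm (poly p z))\<^sup>2 + (norm (poly q z))\<^sup>2 = 1"
  shows "norm (poly_op p T x, poly_op q T x) = norm x"
  using assms(2-)
proof (induction n arbitrary: p q)
  case 0
  then obtain a b where "p = [:a:]" "q = [:b:]"
    by (metis degree_0_id le_zero_eq)
  then have "(norm a)\<^sup>2 + (norm b)\<^sup>2 = 1"
    using 0(3)[of 1] by simp
  then show ?case
    using \<open>p = _\<close> \<open>q = _\<close>
    by (simp add: norm_Pair poly_op_const norm_scaleC power_mult_distrib flip: distrib_right)
next
  case (Suc n)
  obtain \<alpha> \<beta> p' q' where ab: "(norm \<alpha>)\<^sup>2 + (norm \<beta>)\<^sup>2 = 1"
    and IH: "degree p' \<le> n" "degree q' \<le> n"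
      "\<And>z. norm z = 1 \<Longrightarrow> (norm (poly p' z))\<^sup>2 + (norm (poly q' z))\<^sup>2 = 1"
    and eqs: "p = smult \<alpha> (pCons 0 p') + smult (- cnj \<beta>) q'"
      "q = smult \<beta> (pCons 0 p') + smult (cnj \<alpha>) q'"
    using strip_layer[OF Suc.prems] by blast
  show ?case
    using Suc.IH[OF IH]
    by (simp add: poly_op_layer[OF assms(1) eqs] norm_rotate_pair[OF ab] norm_Pair
        clinear_isometry_norm[OF assms(1)])
qed

text \<open>For \<open>p\<close> and \<open>q\<close> of degree at most \<open>2 * d\<close> and
  unitary \<open>U\<close>, this is a column of two trigonometric polynomials of degree at most
  \<open>d\<close> evaluated at \<open>U\<close>.\<close>

definition laurent_pair ::
    "nat \<Rightarrow> complex poly \<Rightarrow> complex poly \<Rightarrow> ('a::complex_hilbert_space \<Rightarrow> 'a) \<Rightarrow> 'a \<Rightarrow> 'a \<times> 'a"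
  where "laurent_pair d p q U x =
    ((inv U ^^ d) (poly_op p U x), (inv U ^^ d) (poly_op q U x))"

lemma norm_laurent_pair:
  assumes "unitary U"
    and "degree p \<le> n" "degree q \<le> n"
    and "\<And>z. norm z = 1 \<Longrightarrow> (norm (poly p z))\<^sup>2 + (norm (poly q z))\<^sup>2 = 1"
  shows "norm (laurent_pair d p q U x) = norm x"
  using norm_poly_op_pair[OF unitary_imp(2)[OF assms(1)] assms(2-)]
  by (simp add: laurent_pair_def norm_Pair
      clinear_isometry_norm[OF clinear_isometry_funpow[OF unitary_imp(3)[OF assms(1)]]])

text \<open>
  The trigonometric degree goes up by one with every two layers: \<open>diag(U, 1) R diag(U, 1)\<close> with a
  scalar rotation \<open>R\<close>, times \<open>inv U\<close>, is \<open>diag(U, 1) R diag(1, inv U)\<close>.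
\<close>

definition two_layer ::
    "complex \<Rightarrow> complex \<Rightarrow> ('a::complex_hilbert_space \<Rightarrow> 'a) \<Rightarrow> 'a \<times> 'a \<Rightarrow> 'a \<times> 'a"
  where "two_layer \<alpha> \<beta> U = (\<lambda>(x, y).
    (\<alpha> *\<^sub>C U x - cnj \<beta> *\<^sub>C y, \<beta> *\<^sub>C x + cnj \<alpha> *\<^sub>C inv U y))"

text \<open>Writing \<open>y\<close> as \<open>U (inv U y)\<close> exhibits the factors diag(U, 1),
  a rotation and diag(1, inv U), all isometric.\<close>

lemma norm_two_layer:
  assumes "unitary U" and "(norm \<alpha>)\<^sup>2 + (norm \<beta>)\<^sup>2 = 1"
  shows "norm (two_layer \<alpha> \<beta> U v) = norm v"
proof -
  note U = unitary_imp[OF assms(1)]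
  obtain x y where v: "v = (x, y)" by (cases v)
  have y: "y = U (inv U y)" using U(1) by (simp add: bij_is_surj surj_f_inv_f)
  have "two_layer \<alpha> \<beta> U v =
    (U (fst (rotate_pair \<alpha> \<beta> (x, inv U y))), snd (rotate_pair \<alpha> \<beta> (x, inv U y)))"
    by (simp add: v two_layer_def rotate_pair_def clinear_isometry_diff[OF U(2)]
        clinear_isometry_scaleC[OF U(2)] y[symmetric])
  then have "norm (two_layer \<alpha> \<beta> U v) = norm (rotate_pair \<alpha> \<beta> (x, inv U y))"
    by (simp add: norm_Pair norm_prod_def clinear_isometry_norm[OF U(2)])
  also have "\<dots> = norm v"
    by (simp add: norm_rotate_pair[OF assms(2)] v norm_Pair clinear_isometry_norm[OF U(3)])
  finally show ?thesis .
qed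

lemma two_layer_diff:
  assumes "unitary U"
  shows "two_layer \<alpha> \<beta> U v - two_layer \<alpha> \<beta> U w = two_layer \<alpha> \<beta> U (v - w)"
  by (cases v; cases w)
    (simp add: two_layer_def clinear_isometry_diff[OF unitary_imp(2)[OF assms]]
      clinear_isometry_diff[OF unitary_imp(3)[OF assms]] scaleC_diff_right)

text \<open>The entries of the two layers off the diagonal are scalars and cancel in the difference.\<close>

lemma norm_two_layer_diff_le:
  assumes "unitary U" "unitary V" and ab: "(norm \<alpha>)\<^sup>2 + (norm \<beta>)\<^sup>2 = 1"
    and c: "\<And>x. norm (U x - V x) \<le> c * norm x" and "0 \<le> c"
  shows "norm (two_layer \<alpha> \<beta> U v - two_layer \<alpha> \<beta> V v) \<le> c * norm v"
proof -
  note U = unitary_imp[OF assms(1)] and V = unitary_imp[OF assms(2)]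
  obtain x y where v: "v = (x, y)" by (cases v)
  have "(norm \<alpha>)\<^sup>2 \<le> 1" using ab by (smt (verit) zero_le_power2)
  then have a1: "norm \<alpha> \<le> 1" by (simp add: power_le_one_iff abs_square_le_1)
  \<comment> \<open>This rests on \<open>inv U - inv V = inv U (V - U) inv V\<close>, where the
    outer factors are isometric.\<close>
  have inv_diff: "norm (inv U y - inv V y) \<le> c * norm y"
  proof -
    have "U (inv U y - inv V y) = V (inv V y) - U (inv V y)"
      using U(1) V(1) by (simp add: clinear_isometry_diff[OF U(2)] bij_is_surj surj_f_inv_f)
    then have "norm (inv U y - inv V y) = norm (U (inv V y) - V (inv V y))"
      by (metis clinear_isometry_norm[OF U(2)] norm_minus_commute)
    also have "\<dots> \<le> c * norm y"
      using c[of "inv V y"] by (simp add: clinear_isometry_norm[OF V(3)])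
    finally show ?thesis .
  qed
  have "two_layer \<alpha> \<beta> U v - two_layer \<alpha> \<beta> V v
      = (\<alpha> *\<^sub>C (U x - V x), cnj \<alpha> *\<^sub>C (inv U y - inv V y))"
    by (simp add: v two_layer_def scaleC_diff_right)
  moreover have "norm (\<alpha> *\<^sub>C (U x - V x)) \<le> c * norm x"
    using mult_mono[OF a1 c[of x]] by (simp add: norm_scaleC)
  moreover have "norm (cnj \<alpha> *\<^sub>C (inv U y - inv V y)) \<le> c * norm y"
    using mult_mono[OF a1 inv_diff] by (simp add: norm_scaleC)
  ultimately have "norm (two_layer \<alpha> \<beta> U v - two_layer \<alpha> \<beta> V v)
      \<le> sqrt ((c * norm x)\<^sup>2 + (c * norm y)\<^sup>2)"
    by (simp add: norm_Pair add_mono power_mono)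
  also have "\<dots> = c * norm v"
    using \<open>0 \<le> c\<close>
    by (simp add: v norm_Pair power_mult_distrib real_sqrt_mult flip: distrib_left)
  finally show ?thesis .
qed

text \<open>Of the \<open>Suc d\<close> inverses, one cancels the outer \<open>U\<close> in the
  first component and stays as the \<open>inv U\<close> of \<open>two_layer\<close> in the second.
  The other \<open>d\<close> commute with \<open>U\<close> and reach the inner pair.\<close>

lemma laurent_pair_two_layer:
  assumes "unitary U"
    and "p = smult \<alpha> (pCons 0 p1) + smult (- cnj \<beta>) q1"
    and "q = smult \<beta> (pCons 0 p1) + smult (cnj \<alpha>) q1"
    and "p1 = smult \<gamma> (pCons 0 p2) + smult (- cnj \<delta>) q2"
    and "q1 = smult \<delta> (pCons 0 p2) + smult (cnj \<gamma>) q2"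
  shows "laurent_pair (Suc d) p q U x
    = rotate_pair \<alpha> \<beta> (two_layer \<gamma> \<delta> U (laurent_pair d p2 q2 U x))"
proof -
  note U = unitary_imp[OF assms(1)]
  have WU: "inv U (U y) = y" and UW: "U (inv U y) = y" for y
    using U(1) by (auto simp: bij_is_inj bij_is_surj surj_f_inv_f)
  have comm: "(inv U ^^ n) (U y) = U ((inv U ^^ n) y)" for n y
    by (induction n) (auto simp: WU UW)
  have Wd: "clinear_isometry (inv U ^^ n)" for n
    by (rule clinear_isometry_funpow[OF U(3)])
  have l1: "(poly_op p U x, poly_op q U x) = rotate_pair \<alpha> \<beta> (U (poly_op p1 U x), poly_op q1 U x)"
    by (rule poly_op_layer[OF U(2) assms(2,3)])
  have l2: "(poly_op p1 U x, poly_op q1 U x) = rotate_pair \<gamma> \<delta> (U (poly_op p2 U x), poly_op q2 U x)"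
    by (rule poly_op_layer[OF U(2) assms(4,5)])
  show ?thesis
    using l1 l2
    by (simp add: laurent_pair_def rotate_pair_def two_layer_def comm WU
        clinear_isometry_diff[OF Wd] clinear_isometry_add[OF Wd] clinear_isometry_scaleC[OF Wd]
        clinear_isometry_diff[OF U(3)] clinear_isometry_add[OF U(3)] clinear_isometry_scaleC[OF U(3)])
qed

text \<open>Telescoping: each double layer contributes at most \<open>c * norm x\<close>, because
  all other factors are isometric.\<close>

lemma norm_laurent_pair_diff_le:
  assumes "unitary U" "unitary V"
    and c: "\<And>x. norm (U x - V x) \<le> c * norm x" and "0 \<le> c"
    and "degree p \<le> 2 * d" "degree q \<le> 2 * d"
    and "\<And>z. norm z = 1 \<Longrightarrow> (norm (poly p z))\<^sup>2 + (norm (poly q z))\<^sup>2 = 1"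
  shows "norm (laurent_pair d p q U x - laurent_pair d p q V x) \<le> real d * c * norm x"
  using assms(5-)
proof (induction d arbitrary: p q)
  case 0
  then show ?case by (simp add: laurent_pair_def poly_op_const)
next
  case (Suc d)
  have "degree p \<le> Suc (Suc (2 * d))" "degree q \<le> Suc (Suc (2 * d))"
    using Suc.prems by auto
  then obtain \<alpha> \<beta> p1 q1 where ab: "(norm \<alpha>)\<^sup>2 + (norm \<beta>)\<^sup>2 = 1"
    and 1: "degree p1 \<le> Suc (2 * d)" "degree q1 \<le> Suc (2 * d)"
      "\<And>z. norm z = 1 \<Longrightarrow> (norm (poly p1 z))\<^sup>2 + (norm (poly q1 z))\<^sup>2 = 1"
    and eqs1: "p = smult \<alpha> (pCons 0 p1) + smult (- cnj \<beta>) q1"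
      "q = smult \<beta> (pCons 0 p1) + smult (cnj \<alpha>) q1"
    using strip_layer[OF _ _ Suc.prems(3)] by blast
  obtain \<gamma> \<delta> p2 q2 where gd: "(norm \<gamma>)\<^sup>2 + (norm \<delta>)\<^sup>2 = 1"
    and 2: "degree p2 \<le> 2 * d" "degree q2 \<le> 2 * d"
      "\<And>z. norm z = 1 \<Longrightarrow> (norm (poly p2 z))\<^sup>2 + (norm (poly q2 z))\<^sup>2 = 1"
    and eqs2: "p1 = smult \<gamma> (pCons 0 p2) + smult (- cnj \<delta>) q2"
      "q1 = smult \<delta> (pCons 0 p2) + smult (cnj \<gamma>) q2"
    using strip_layer[OF 1] by blast
  define A where "A = laurent_pair d p2 q2 U x"
  define B where "B = laurent_pair d p2 q2 V x"
  have "norm (laurent_pair (Suc d) p q U x - laurent_pair (Suc d) p q V x)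
      = norm (two_layer \<gamma> \<delta> U A - two_layer \<gamma> \<delta> V B)"
    by (simp add: laurent_pair_two_layer[OF assms(1) eqs1 eqs2]
        laurent_pair_two_layer[OF assms(2) eqs1 eqs2] rotate_pair_diff norm_rotate_pair[OF ab]
        A_def B_def)
  \<comment> \<open>The change of input from \<open>B\<close> to \<open>A\<close> is carried
    isometrically; the change of operator acts on \<open>B\<close>, whose norm is
    \<open>norm x\<close>.\<close>
  also have "\<dots> = norm (two_layer \<gamma> \<delta> U (A - B)
      + (two_layer \<gamma> \<delta> U B - two_layer \<gamma> \<delta> V B))"
    by (simp flip: two_layer_diff[OF assms(1)])
  also have "\<dots> \<le> norm (A - B) + c * norm B"
    using norm_two_layer_diff_le[OF assms(1,2) gd c \<open>0 \<le> c\<close>, of B]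
    by (intro norm_triangle_le) (simp add: norm_two_layer[OF assms(1) gd])
  also have "\<dots> \<le> real d * c * norm x + c * norm x"
    using Suc.IH[OF 2] norm_laurent_pair[OF assms(2) 2, of d x]
    by (simp add: A_def B_def)
  finally show ?case by (simp add: algebra_simps)
qed

section \<open>Trigonometric polynomials of unitary operators\<close>

text \<open>The ordinary polynomial \<open>z ^ d * f z\<close>, whose index \<open>i\<close> stands
  for the exponent \<open>i - d\<close> of \<open>f\<close>.\<close>

definition shifted_poly :: "nat \<Rightarrow> (int \<Rightarrow> complex) \<Rightarrow> complex poly"
  where "shifted_poly d a = (\<Sum>i\<le>2 * d. monom (a (int i - int d)) i)"

lemma coeff_shifted_poly:
  "coeff (shifted_poly d a) i = (if i \<le> 2 * d then a (int i - int d) else 0)"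
  by (auto simp: shifted_poly_def coeff_sum)

lemma degree_shifted_poly_le: "degree (shifted_poly d a) \<le> 2 * d"
  by (rule degree_le) (auto simp: coeff_shifted_poly)

lemma sum_symmetric_interval_shift:
  "(\<Sum>k = - int d..int d. g k) = (\<Sum>i\<le>2 * d. g (int i - int d))"
  by (rule sum.reindex_bij_witness[of _ "\<lambda>i. int i - int d" "\<lambda>k. nat (k + int d)"]) auto

lemma poly_shifted_poly:
  assumes "z \<noteq> 0"
  shows "poly (shifted_poly d a) z = z ^ d * trig_poly d a z"
proof -
  have "z ^ d * z powi (int i - int d) = z ^ i" for i
    using assms by (simp add: power_int_diff)
  then have "z ^ d * (c * z powi (int i - int d)) = c * z ^ i" for c i
    by (metis mult.left_commute)
  then show ?thesis
    unfolding shifted_poly_def trig_poly_def sum_symmetric_interval_shift sum_distrib_left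
    by (simp only: poly_sum poly_monom)
qed

text \<open>Each inverse cancels one \<open>U\<close> until one kind runs out; at
  \<open>i = 0\<close> only inverses are left.\<close>

lemma op_powi_shift:
  assumes "bij U"
  shows "(inv U ^^ d) ((U ^^ i) x) = op_powi U (int i - int d) x"
proof (induction d arbitrary: i)
  case 0
  then show ?case by (simp add: op_powi_def)
next
  case (Suc d)
  show ?case
  proof (cases i)
    case 0
    have "nat (int d + 1) = Suc d" by simp
    with 0 show ?thesis by (simp add: op_powi_def)
  next
    case (Suc j)
    have "(inv U ^^ Suc d) ((U ^^ i) x) = (inv U ^^ d) ((U ^^ j) x)"
      using assms by (simp only: Suc funpow_Suc_right[of d] funpow.simps(2)[of j] comp_apply
          inv_f_f[OF bij_is_inj])
    then show ?thesis using Suc.IH[of j] Suc by simp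
  qed
qed

text \<open>This identifies \<open>f(U)\<close> with the first component of a
  \<open>laurent_pair\<close>.\<close>

lemma trig_poly_op_eq:
  assumes "unitary U"
  shows "trig_poly_op d a U x = (inv U ^^ d) (poly_op (shifted_poly d a) U x)"
proof -
  note U = unitary_imp[OF assms]
  have Wd: "clinear_isometry (inv U ^^ d)"
    by (rule clinear_isometry_funpow[OF U(3)])
  show ?thesis
    by (simp add: poly_op_eq_sum_le[OF degree_shifted_poly_le] coeff_shifted_poly
        clinear_isometry_sum[OF Wd] clinear_isometry_scaleC[OF Wd] op_powi_shift[OF U(1)]
        trig_poly_op_def sum_symmetric_interval_shift)
qed

theorem theorem5p13:
  fixes d :: nat and a :: "int \<Rightarrow> complex"
    and U V :: "'a::complex_hilbert_space \<Rightarrow> 'a"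
  assumes "\<And>\<zeta>. norm \<zeta> = 1 \<Longrightarrow> norm (trig_poly d a \<zeta>) \<le> 1"
    and "unitary U" and "unitary V"
  shows "onorm (\<lambda>x. trig_poly_op d a U x - trig_poly_op d a V x)
           \<le> real d * onorm (\<lambda>x. U x - V x)"
proof -
  define c where "c = onorm (\<lambda>x. U x - V x)"
  have bl: "bounded_linear (\<lambda>x. U x - V x)"
    using assms(2,3) by (auto simp: unitary_def bounded_clinear_def intro: bounded_linear_sub)
  have c: "norm (U x - V x) \<le> c * norm x" for x
    unfolding c_def by (rule onorm[OF bl])
  have "0 \<le> c" unfolding c_def by (rule onorm_pos_le[OF bl])
  have "norm (trig_poly_op d a U x - trig_poly_op d a V x) \<le> real d * c * norm x" for x
  \<comment> \<open>Scaling by \<open>r < 1\<close> gives the strict bound that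
    \<open>complementary_poly\<close> requires; the estimate for all such \<open>r\<close> yields
    the one without \<open>r\<close>.\<close>
  proof (rule field_le_mult_one_interval)
    fix r :: real assume r: "0 < r" "r < 1"
    define p where "p = smult (of_real r) (shifted_poly d a)"
    have deg: "degree p \<le> 2 * d"
      unfolding p_def using degree_smult_le degree_shifted_poly_le by (rule order_trans)
    have "norm (poly p z) < 1" if z: "norm z = 1" for z
    proof -
      have "z \<noteq> 0" using z by auto
      then have "norm (poly p z) = r * norm (trig_poly d a z)"
        using r z by (simp add: p_def poly_shifted_poly norm_mult norm_power)
      also have "\<dots> \<le> r * 1"
        using assms(1)[OF z] r by (intro mult_left_mono) auto
      finally show ?thesis using r by simp
    qed
    then obtain q where q: "degree q \<le> 2 * d"
      "\<And>z. norm z = 1 \<Longrightarrow> (norm (poly p z))\<^sup>2 + (norm (poly q z))\<^sup>2 = 1"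
      using complementary_poly[OF deg] by blast
    \<comment> \<open>The column contains \<open>r * f\<close> as its first entry, and the norm of a
      component is at most that of the pair.\<close>
    have fst: "fst (laurent_pair d p q T x) = of_real r *\<^sub>C trig_poly_op d a T x"
      if "unitary T" for T :: "'a \<Rightarrow> 'a"
      by (simp add: laurent_pair_def p_def poly_op_smult trig_poly_op_eq[OF that]
          clinear_isometry_scaleC[OF clinear_isometry_funpow[OF unitary_imp(3)[OF that]]])
    have "r * norm (trig_poly_op d a U x - trig_poly_op d a V x)
        = norm (of_real r *\<^sub>C (trig_poly_op d a U x - trig_poly_op d a V x))"
      using r by (simp add: norm_scaleC)
    also have "\<dots> = norm (fst (laurent_pair d p q U x - laurent_pair d p q V x))"
      by (simp add: fst assms(2,3) scaleC_diff_right)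
    also have "\<dots> \<le> norm (laurent_pair d p q U x - laurent_pair d p q V x)"
      by (metis norm_fst_le prod.collapse)
    also have "\<dots> \<le> real d * c * norm x"
      by (rule norm_laurent_pair_diff_le[OF assms(2,3) c \<open>0 \<le> c\<close> deg q])
    finally show "r * norm (trig_poly_op d a U x - trig_poly_op d a V x)
        \<le> real d * c * norm x" .
  qed
  then show ?thesis
    unfolding c_def[symmetric] using \<open>0 \<le> c\<close> by (intro onorm_bound) auto
qed

end
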